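(* Let $G$ be a finite simple bipartite graph. Then there exist disjoint sets $S,T$ with $S\cup T=V(G)$ satisfying the following conditions: (a) $G$ has a matching $M$ with $M\subseteq E_G(S,T)$ such that $M$ saturates $S$; (b) $T$ is an independent set in $G$.
   Context: All graphs are finite and simple. For disjoint $S,T\subseteq V(G)$, $E_G(S,T)$ is the set of edges of $G$ with one endvertex in $S$ and the other in $T$. A matching $M$ saturates $S$ if every vertex of $S$ is an endvertex of an edge of $M$. The partition $S\cup T$ of $V(G)$ is not required to be a bipartition of $G$ (edges inside $S$ are allowed). *)

theory Defs
  imports Main
begin

text \<open>A graph is given by its vertex set \<open>V\<close> and its edge set \<open>E\<close>. Edges are
  two-element subsets of \<open>V\<close>, which rules out loops and multiple edges. The empty
  graph is allowed.\<close>

definition fin_simple_graph :: "'a set \<Rightarrow> 'a set set \<Rightarrow> bool" where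
  "fin_simple_graph V E \<longleftrightarrow> finite V \<and> (\<forall>e\<in>E. e \<subseteq> V \<and> card e = 2)"

definition edges_between :: "'a set set \<Rightarrow> 'a set \<Rightarrow> 'a set \<Rightarrow> 'a set set" where
  "edges_between E S T = {e \<in> E. \<exists>s\<in>S. \<exists>t\<in>T. e = {s, t}}"

definition bipartite_graph :: "'a set \<Rightarrow> 'a set set \<Rightarrow> bool" where
  "bipartite_graph V E \<longleftrightarrow>
     (\<exists>A B. A \<inter> B = {} \<and> A \<union> B = V \<and> E \<subseteq> edges_between E A B)"

definition graph_matching :: "'a set set \<Rightarrow> 'a set set \<Rightarrow> bool" where
  "graph_matching E M \<longleftrightarrow> M \<subseteq> E \<and> (\<forall>e\<in>M. \<forall>f\<in>M. e \<noteq> f \<longrightarrow> e \<inter> f = {})"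

definition saturates :: "'a set set \<Rightarrow> 'a set \<Rightarrow> bool" where
  "saturates M S \<longleftrightarrow> (\<forall>v\<in>S. \<exists>e\<in>M. v \<in> e)"

definition independent_set :: "'a set \<Rightarrow> 'a set set \<Rightarrow> 'a set \<Rightarrow> bool" where
  "independent_set V E T \<longleftrightarrow> T \<subseteq> V \<and> (\<forall>u\<in>T. \<forall>v\<in>T. {u, v} \<notin> E)"

end

(* Take S to be a minimum vertex cover and T its complement. Following the Lovasz-Plummer proof of
   Koenig's theorem, let F be a minimal set of edges that still has no cover smaller than S. If two
   edges x, y of F met in v, minimality would give small covers X, Y of F - {x}, F - {y}; every edge
   of F meets X \<inter> Y or lies in the set H consisting of v and the symmetric difference of X and Y, so
   adding the smaller colour class of H to X \<inter> Y would give a small cover of F. Hence F is a matching.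
   Choosing an endvertex of each edge covers F, so F has at least card S edges; as each of these
   disjoint edges meets S, each meets it exactly once and all of S is used. *)

theory Submission
  imports Defs
begin

definition vertex_cover :: "'a set set \<Rightarrow> 'a set \<Rightarrow> bool" where
  "vertex_cover E C \<longleftrightarrow> (\<forall>e\<in>E. e \<inter> C \<noteq> {})"

lemma bipartite_graph_meets_classes:
  assumes "bipartite_graph V E"
  obtains A B where "A \<inter> B = {}" "\<And>e. e \<in> E \<Longrightarrow> e \<inter> A \<noteq> {} \<and> e \<inter> B \<noteq> {}"
  using assms unfolding bipartite_graph_def edges_between_def by blast

text \<open>If two edges met in \<open>v\<close>, their critical covers \<open>X\<close> and
  \<open>Y\<close> could be recombined into two covers of \<open>F\<close>, one for each colour
  class, whose sizes sum to at most \<open>card X + card Y + 1\<close>. As \<open>X\<close> and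
  \<open>Y\<close> both have fewer than \<open>k\<close> vertices, this is below
  \<open>2 * k\<close>.\<close>

lemma cover_critical_disjoint:
  fixes k :: nat
  assumes "finite V"
    and edges: "\<And>e. e \<in> F \<Longrightarrow> e \<subseteq> V \<and> card e = 2"
    and AB: "A \<inter> B = {}" "\<And>e. e \<in> F \<Longrightarrow> e \<inter> A \<noteq> {} \<and> e \<inter> B \<noteq> {}"
    and large: "\<And>C. C \<subseteq> V \<Longrightarrow> vertex_cover F C \<Longrightarrow> k \<le> card C"
    and critical: "\<And>e. e \<in> F \<Longrightarrow> \<exists>C\<subseteq>V. vertex_cover (F - {e}) C \<and> card C < k"
    and "x \<in> F" "y \<in> F" "x \<noteq> y"
  shows "x \<inter> y = {}"
proof (rule ccontr)
  assume "x \<inter> y \<noteq> {}"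
  then obtain v where v: "v \<in> x" "v \<in> y" by blast
  obtain X where X: "X \<subseteq> V" "vertex_cover (F - {x}) X" "card X < k"
    using critical \<open>x \<in> F\<close> by blast
  obtain Y where Y: "Y \<subseteq> V" "vertex_cover (F - {y}) Y" "card Y < k"
    using critical \<open>y \<in> F\<close> by blast
  have fin: "finite X" "finite Y"
    using X(1) Y(1) \<open>finite V\<close> finite_subset by blast+
  \<comment> \<open>A vertex of \<open>x\<close> in \<open>X\<close> would make \<open>X\<close>
    cover all of \<open>F\<close> with fewer than \<open>k\<close> vertices.\<close>
  have xX: "x \<inter> X = {}"
  proof (rule ccontr)
    assume "x \<inter> X \<noteq> {}"
    then have "vertex_cover F X" using X(2) by (auto simp: vertex_cover_def)
    then show False using large[OF X(1)] X(3) by simp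
  qed
  have yY: "y \<inter> Y = {}"
  proof (rule ccontr)
    assume "y \<inter> Y \<noteq> {}"
    then have "vertex_cover F Y" using Y(2) by (auto simp: vertex_cover_def)
    then show False using large[OF Y(1)] Y(3) by simp
  qed
  define H where "H = insert v ((X - Y) \<union> (Y - X))"
  have "v \<in> V" using edges[OF \<open>x \<in> F\<close>] v by blast
  then have "H \<subseteq> V" using X(1) Y(1) by (auto simp: H_def)
  have H: "e \<inter> (X \<inter> Y) \<noteq> {} \<or> e \<subseteq> H" if "e \<in> F" for e
  proof -
    obtain p q where e: "e = {p, q}"
      using edges[THEN conjunct2, OF \<open>e \<in> F\<close>] by (meson card_2_iff)
    have X': "p \<in> X \<or> q \<in> X" if "e \<noteq> x"
    proof -
      have "e \<inter> X \<noteq> {}"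
        using X(2) \<open>e \<in> F\<close> that by (simp add: vertex_cover_def)
      then show ?thesis unfolding e by blast
    qed
    have Y': "p \<in> Y \<or> q \<in> Y" if "e \<noteq> y"
    proof -
      have "e \<inter> Y \<noteq> {}"
        using Y(2) \<open>e \<in> F\<close> that by (simp add: vertex_cover_def)
      then show ?thesis unfolding e by blast
    qed
    consider "e = x" | "e = y" | "e \<noteq> x" "e \<noteq> y" by blast
    then show ?thesis
    proof cases
      case 1
      \<comment> \<open>Since \<open>x\<close> differs from \<open>y\<close>, it is still covered by
        \<open>Y\<close>, but not at \<open>v\<close>, because \<open>v\<close> lies in
        \<open>y\<close> and \<open>Y\<close> avoids \<open>y\<close>. So the other end is in
        \<open>Y - X\<close>, while \<open>v\<close> was put into \<open>H\<close> by hand.\<close>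
      then have "p \<notin> X" "q \<notin> X" "v = p \<or> v = q" "p \<in> Y \<or> q \<in> Y" "v \<notin> Y"
        using Y' xX yY v \<open>x \<noteq> y\<close> e by blast+
      then show ?thesis unfolding e H_def by blast
    next
      case 2
      then have "p \<notin> Y" "q \<notin> Y" "v = p \<or> v = q" "p \<in> X \<or> q \<in> X" "v \<notin> X"
        using X' xX yY v \<open>x \<noteq> y\<close> e by blast+
      then show ?thesis unfolding e H_def by blast
    next
      case 3
      \<comment> \<open>If no end lies in both covers, one end lies in \<open>X - Y\<close> and the
        other in \<open>Y - X\<close>.\<close>
      then have "p \<in> X \<or> q \<in> X" "p \<in> Y \<or> q \<in> Y" using X' Y' by simp_all
      then show ?thesis unfolding e H_def by blast
    qed
  qed
  \<comment> \<open>\<open>P\<close> will be each colour class in turn: an edge inside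
    \<open>H\<close> is then covered by its end in \<open>P\<close>.\<close>
  have bound: "k \<le> card (X \<inter> Y) + card (H \<inter> P)" if "\<And>e. e \<in> F \<Longrightarrow> e \<inter> P \<noteq> {}" for P
  proof -
    have "vertex_cover F (X \<inter> Y \<union> H \<inter> P)"
      unfolding vertex_cover_def
    proof
      fix e assume "e \<in> F"
      show "e \<inter> (X \<inter> Y \<union> H \<inter> P) \<noteq> {}"
        using H[OF \<open>e \<in> F\<close>] that[OF \<open>e \<in> F\<close>] by blast
    qed
    then have "k \<le> card (X \<inter> Y \<union> H \<inter> P)"
      using \<open>H \<subseteq> V\<close> X(1) by (intro large) auto
    then show ?thesis using card_Un_le le_trans by blast
  qed
  have "finite H" using fin by (simp add: H_def)
  have "card (H \<inter> A) + card (H \<inter> B) = card ((H \<inter> A) \<union> (H \<inter> B))"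
    using AB(1) \<open>finite H\<close> by (subst card_Un_disjoint) auto
  also have "\<dots> \<le> card H" using \<open>finite H\<close> by (intro card_mono) auto
  also have "\<dots> \<le> Suc (card ((X - Y) \<union> (Y - X)))"
    unfolding H_def by (rule card_insert_le_m1) auto
  also have "\<dots> \<le> Suc (card (X - Y) + card (Y - X))"
    using card_Un_le by auto
  finally have "card (H \<inter> A) + card (H \<inter> B) \<le> Suc (card (X - Y) + card (Y - X))" .
  moreover have "card X = card (X \<inter> Y) + card (X - Y)"
    "card Y = card (X \<inter> Y) + card (Y - X)"
    using fin by (metis card_Int_Diff inf_commute)+
  \<comment> \<open>Adding the bounds for \<open>A\<close> and \<open>B\<close> gives
    \<open>2 * k \<le> card X + card Y + 1\<close>, whereas \<open>card X\<close> and
    \<open>card Y\<close> are at most \<open>k - 1\<close>. The single extra unit contributed by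
    \<open>v\<close> is just affordable.\<close>
  ultimately show False
    using bound[OF conjunct1[OF AB(2)]] bound[OF conjunct2[OF AB(2)]] X(3) Y(3) by linarith
qed

text \<open>An edge set of least size that keeps the lower bound \<open>k\<close> on covers loses
  the bound when any edge is deleted, so its edges are pairwise disjoint.\<close>

lemma bipartite_cover_critical_matching:
  fixes k :: nat
  assumes G: "fin_simple_graph V E" "bipartite_graph V E"
    and large: "\<And>C. C \<subseteq> V \<Longrightarrow> vertex_cover E C \<Longrightarrow> k \<le> card C"
  obtains F where "graph_matching E F"
    "\<And>C. C \<subseteq> V \<Longrightarrow> vertex_cover F C \<Longrightarrow> k \<le> card C"
proof -
  have "finite V" and edges: "\<And>e. e \<in> E \<Longrightarrow> e \<subseteq> V \<and> card e = 2"
    using G(1) unfolding fin_simple_graph_def by auto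
  then have "finite E" by (meson Pow_iff finite_Pow_iff finite_subset subsetI)
  obtain A B where AB: "A \<inter> B = {}" "\<And>e. e \<in> E \<Longrightarrow> e \<inter> A \<noteq> {} \<and> e \<inter> B \<noteq> {}"
    using bipartite_graph_meets_classes[OF G(2)] by blast
  define good where "good F \<longleftrightarrow> F \<subseteq> E \<and> (\<forall>C\<subseteq>V. vertex_cover F C \<longrightarrow> k \<le> card C)" for F
  have "good E" using large by (simp add: good_def)
  then obtain F where F: "good F" and min: "\<And>F'. good F' \<Longrightarrow> card F \<le> card F'"
    using ex_has_least_nat[of good E card] by blast
  have "F \<subseteq> E" "finite F"
    using F \<open>finite E\<close> finite_subset by (auto simp: good_def)
  have critical: "\<exists>C\<subseteq>V. vertex_cover (F - {e}) C \<and> card C < k" if "e \<in> F" for e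
  proof (rule ccontr)
    assume "\<not> ?thesis"
    then have "good (F - {e})" using F by (force simp: good_def)
    from min[OF this] show False
      using card_Diff1_less[OF \<open>finite F\<close> that] by simp
  qed
  have large': "\<And>C. C \<subseteq> V \<Longrightarrow> vertex_cover F C \<Longrightarrow> k \<le> card C"
    using F by (simp add: good_def)
  have "x \<inter> y = {}" if "x \<in> F" "y \<in> F" "x \<noteq> y" for x y
  proof (rule cover_critical_disjoint[OF \<open>finite V\<close> _ AB(1) _ large' critical that])
  qed (use edges AB(2) \<open>F \<subseteq> E\<close> in auto)
  then have "graph_matching E F"
    using \<open>F \<subseteq> E\<close> by (simp add: graph_matching_def)
  then show thesis using large' that by blast
qed

text \<open>Picking a vertex of \<open>S\<close> in each edge is injective by disjointness, hence
  onto \<open>S\<close> by the size bound. A second vertex of \<open>S\<close> in an edge would be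
  the one picked by another edge, which would then meet the first.\<close>

lemma disjoint_edges_small_cover:
  assumes "finite S" "vertex_cover F S" "card S \<le> card F"
    and disj: "\<And>e f. e \<in> F \<Longrightarrow> f \<in> F \<Longrightarrow> e \<noteq> f \<Longrightarrow> e \<inter> f = {}"
  shows "S \<subseteq> \<Union>F" and "\<And>e. e \<in> F \<Longrightarrow> card (e \<inter> S) = 1"
proof -
  have "\<forall>e\<in>F. \<exists>v. v \<in> e \<inter> S"
    using assms(2) unfolding vertex_cover_def by blast
  from bchoice[OF this] obtain r where r: "\<forall>e\<in>F. r e \<in> e \<inter> S" ..
  have "inj_on r F"
    using r disj by (intro inj_onI) (metis IntD1 disjoint_iff)
  then have S: "r ` F = S"
    using r assms(1,3) by (intro card_seteq) (auto simp: card_image)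
  show "S \<subseteq> \<Union>F" using S r by blast
  fix e assume "e \<in> F"
  have "s = r e" if s: "s \<in> e \<inter> S" for s
  proof -
    obtain f where "f \<in> F" "s = r f" using S s by blast
    then show ?thesis using disj[OF \<open>e \<in> F\<close> \<open>f \<in> F\<close>] r s by blast
  qed
  then have "e \<inter> S = {r e}" using r \<open>e \<in> F\<close> by blast
  then show "card (e \<inter> S) = 1" by simp
qed

theorem lemma9:
  fixes V :: "'a set" and E :: "'a set set"
  assumes "fin_simple_graph V E"
    and "bipartite_graph V E"
  shows "\<exists>S T. S \<inter> T = {} \<and> S \<union> T = V \<and>
           (\<exists>M. graph_matching E M \<and> M \<subseteq> edges_between E S T \<and> saturates M S) \<and>
           independent_set V E T"
proof -
  have "finite V" and edges: "\<And>e. e \<in> E \<Longrightarrow> e \<subseteq> V \<and> card e = 2"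
    using assms(1) unfolding fin_simple_graph_def by auto
  then have "finite E" by (meson Pow_iff finite_Pow_iff finite_subset subsetI)
  \<comment> \<open>Some cover inside \<open>V\<close> must exist before one of least size can be
    chosen.\<close>
  have "vertex_cover E V"
    using edges unfolding vertex_cover_def by (metis card.empty inf.absorb1 zero_neq_numeral)
  then obtain S where S: "S \<subseteq> V" "vertex_cover E S"
    and min: "\<And>C. C \<subseteq> V \<Longrightarrow> vertex_cover E C \<Longrightarrow> card S \<le> card C"
    using ex_has_least_nat[of "\<lambda>C. C \<subseteq> V \<and> vertex_cover E C" V card] by blast
  obtain F where F: "graph_matching E F"
    and large: "\<And>C. C \<subseteq> V \<Longrightarrow> vertex_cover F C \<Longrightarrow> card S \<le> card C"
    using bipartite_cover_critical_matching[OF assms min] by blast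
  have "F \<subseteq> E" and disj: "\<And>e f. e \<in> F \<Longrightarrow> f \<in> F \<Longrightarrow> e \<noteq> f \<Longrightarrow> e \<inter> f = {}"
    using F by (auto simp: graph_matching_def)
  have cover: "vertex_cover F S"
    using S(2) \<open>F \<subseteq> E\<close> by (auto simp: vertex_cover_def)
  then have "\<forall>e\<in>F. \<exists>v. v \<in> e"
    unfolding vertex_cover_def by blast
  from bchoice[OF this] obtain r where r: "\<forall>e\<in>F. r e \<in> e" ..
  have "card S \<le> card (r ` F)"
    using r edges \<open>F \<subseteq> E\<close> by (intro large) (blast, unfold vertex_cover_def, blast)
  also have "\<dots> \<le> card F"
    using \<open>finite E\<close> \<open>F \<subseteq> E\<close> card_image_le finite_subset by blast
  finally have "card S \<le> card F" .
  then have "S \<subseteq> \<Union>F" and one: "\<And>e. e \<in> F \<Longrightarrow> card (e \<inter> S) = 1"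
    using disjoint_edges_small_cover[OF _ cover _ disj] \<open>finite V\<close> S(1) finite_subset by blast+
  then have "saturates F S" by (auto simp: saturates_def)
  moreover have "F \<subseteq> edges_between E S (V - S)"
  proof
    fix e assume "e \<in> F"
    then have "e \<in> E" using \<open>F \<subseteq> E\<close> by blast
    obtain p q where e: "e = {p, q}" "p \<noteq> q"
      using edges[THEN conjunct2, OF \<open>e \<in> E\<close>] by (meson card_2_iff)
    then have "p \<in> V" "q \<in> V" using edges \<open>e \<in> E\<close> by blast+
    have "p \<in> S \<longleftrightarrow> q \<notin> S"
      using one[OF \<open>e \<in> F\<close>] e by (cases "p \<in> S"; cases "q \<in> S") simp_all
    then have "p \<in> S \<and> q \<in> V - S \<or> q \<in> S \<and> p \<in> V - S"
      using \<open>p \<in> V\<close> \<open>q \<in> V\<close> by blast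
    then show "e \<in> edges_between E S (V - S)"
      using \<open>e \<in> E\<close> e(1) unfolding edges_between_def by (auto simp: insert_commute)
  qed
  \<comment> \<open>An edge with both ends in \<open>V - S\<close> would escape the cover
    \<open>S\<close>; the case \<open>u = v\<close> is excluded by the same argument.\<close>
  moreover have "independent_set V E (V - S)"
    using S(2) by (force simp: independent_set_def vertex_cover_def)
  ultimately have "\<exists>M. graph_matching E M \<and> M \<subseteq> edges_between E S (V - S) \<and> saturates M S"
    "independent_set V E (V - S)"
    using F by blast+
  then show ?thesis
    using S(1) by (intro exI[of _ S] exI[of _ "V - S"] conjI) auto
qed

end
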